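(* Algorithm 1 (the fuzzy $c$-means clustering algorithm for trajectory data described in the context) is frame-independent. That is: let $\{x_{i,t}\}_{1\le i\le n,\,0\le t\le T}\subset\mathbb{R}^d$ be a collection of trajectories, and let $y_{i,t}:=O_tx_{i,t}+o_t$ be the transformed trajectories, where for each $t=0,1,\ldots,T$, $O_t$ is an orthogonal $d\times d$ matrix and $o_t\in\mathbb{R}^d$. If Algorithm 1 applied to $\{x_{i,t}\}$ yields centres $C_k=(c_{k,0},\ldots,c_{k,T})\in\mathbb{R}^{d(T+1)}$, $k=1,\ldots,K$, and likelihoods $u_{k,i}$, $k=1,\ldots,K$, $i=1,\ldots,n$ (minimising the objective for the dataset $\{x_{i,t}\}$), then Algorithm 1 applied to $\{y_{i,t}\}$ yields the transformed output: the centres $C'_k=(c'_{k,0},\ldots,c'_{k,T})$ with $c'_{k,t}=O_tc_{k,t}+o_t$, and the same likelihoods $u_{k,i}$ (minimising the objective for the dataset $\{y_{i,t}\}$).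
   Context: All norms $\|\cdot\|$ are Euclidean. There are $n$ trajectories $\{x_{i,t}\}_{0\le t\le T}$, $i=1,\ldots,n$, with $x_{i,t}\in\mathbb{R}^d$, sampled at the times $t=0,1,\ldots,T$. Each trajectory is regarded as a point $X_i=(x_{i,0},x_{i,1},\ldots,x_{i,T})\in\mathbb{R}^{d(T+1)}$. One seeks $K$ cluster centres $C_k=(c_{k,0},c_{k,1},\ldots,c_{k,T})\in\mathbb{R}^{d(T+1)}$ with $c_{k,t}\in\mathbb{R}^d$, and membership likelihoods $0\le u_{k,i}\le 1$ of trajectory $X_i$ being associated with centre $C_k$. The objective to be minimised is $$\sum_{k=1}^K\sum_{i=1}^n u_{k,i}^m\|X_i-C_k\|^2=\sum_{k=1}^K\sum_{i=1}^n u_{k,i}^m\sum_{t=0}^T\|x_{i,t}-c_{k,t}\|^2,$$ subject to $\sum_{k=1}^K u_{k,i}=1$ for $i=1,\ldots,n$ and $u_{k,i}\ge 0$ for all $k,i$. The parameter $m>1$ is the fuzziness exponent. Algorithm 1: 1. Initialize membership values $u_{k,i}$ either randomly or computed via step 3 based on an initial seeding of $K$ centres (e.g. randomly or by the $k$-means++ algorithm). 2. Calculate centres: $C_k=\dfrac{\sum_{i=1}^n u_{k,i}^mX_i}{\sum_{i=1}^n u_{k,i}^m}$, $k=1,\ldots,K$. 3. Update membership values: $u_{k,i}=\dfrac{1/\|X_i-C_k\|^{2/(m-1)}}{\sum_{j=1}^K\left(1/\|X_i-C_j\|^{2/(m-1)}\right)}$, $k=1,\ldots,K$, $i=1,\ldots,n$.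 4. Evaluate the objective. If the improvement in the objective is below a threshold, go to step 5; otherwise go to step 2. 5. Output cluster centres $C_k\in\mathbb{R}^{d(T+1)}$, $k=1,\ldots,K$, and membership likelihoods $u_{k,i}\in[0,1]$, $k=1,\ldots,K$, $i=1,\ldots,n$. The output of Algorithm 1 on a dataset is understood to be centres and likelihoods that minimise the objective for that dataset. Frame-independence: to check frame-independence of an algorithm, one applies the algorithm to an original dataset, then subjects the dataset to a (possibly time-dependent) affine transformation whose linear part is orthogonal. If the algorithm applied to the transformed dataset yields the transformed output of the original dataset, then the algorithm is frame-independent. *)

theory Defs
  imports "HOL-Analysis.Analysis"
begin

text \<open>
  A family of trajectories (the data or the cluster centres) is a function of the label and of the
  time, of which only the labels \<open>1..n\<close> (data) or \<open>1..K\<close> (centres) and the times \<open>0..T\<close> matter;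
  \<open>u k i\<close> is the membership likelihood of trajectory \<open>i\<close> in cluster \<open>k\<close>.
\<close>

type_synonym 'd family = "nat \<Rightarrow> nat \<Rightarrow> real^'d"

definition traj_dist :: "nat \<Rightarrow> (nat \<Rightarrow> real^'d) \<Rightarrow> (nat \<Rightarrow> real^'d) \<Rightarrow> real" where
  "traj_dist T X Y = L2_set (\<lambda>t. norm (X t - Y t)) {0..T}"

definition memberships :: "nat \<Rightarrow> nat \<Rightarrow> (nat \<Rightarrow> nat \<Rightarrow> real) \<Rightarrow> bool" where
  "memberships K n u \<longleftrightarrow>
     (\<forall>k\<in>{1..K}. \<forall>i\<in>{1..n}. 0 \<le> u k i) \<and> (\<forall>i\<in>{1..n}. (\<Sum>k=1..K. u k i) = 1)"

definition fcm_objective ::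
  "real \<Rightarrow> nat \<Rightarrow> nat \<Rightarrow> nat \<Rightarrow> 'd::finite family \<Rightarrow> 'd::finite family \<Rightarrow> (nat \<Rightarrow> nat \<Rightarrow> real) \<Rightarrow> real" where
  "fcm_objective m K n T x C u =
     (\<Sum>k=1..K. \<Sum>i=1..n. u k i powr m * (traj_dist T (x i) (C k))\<^sup>2)"

definition fcm_minimiser ::
  "real \<Rightarrow> nat \<Rightarrow> nat \<Rightarrow> nat \<Rightarrow> 'd::finite family \<Rightarrow> 'd::finite family \<Rightarrow> (nat \<Rightarrow> nat \<Rightarrow> real) \<Rightarrow> bool" where
  "fcm_minimiser m K n T x C u \<longleftrightarrow>
     memberships K n u \<and>
     (\<forall>D v. memberships K n v \<longrightarrow> fcm_objective m K n T x C u \<le> fcm_objective m K n T x D v)"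

text \<open>
  The centre update is undefined for an empty cluster, so an iteration that meets one is not
  a step of the algorithm.
\<close>

definition centre_update ::
  "real \<Rightarrow> nat \<Rightarrow> nat \<Rightarrow> nat \<Rightarrow> 'd::finite family \<Rightarrow> (nat \<Rightarrow> nat \<Rightarrow> real) \<Rightarrow> 'd::finite family \<Rightarrow> bool" where
  "centre_update m K n T x u C \<longleftrightarrow>
     (\<forall>k\<in>{1..K}. (\<Sum>i=1..n. u k i powr m) \<noteq> 0 \<and>
        (\<forall>t\<in>{0..T}. C k t = (\<Sum>i=1..n. u k i powr m *\<^sub>R x i t) /\<^sub>R (\<Sum>i=1..n. u k i powr m)))"

text \<open>
  The membership formula is undefined when a trajectory coincides with some centre, which happens
  for instance whenever the seeds are chosen among the data, as \<open>k\<close>-means++ does. In that case the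
  usual convention for fuzzy \<open>c\<close>-means is adopted: the likelihoods of that trajectory are
  distributed, in any way, among the centres it coincides with.
\<close>

definition membership_update ::
  "real \<Rightarrow> nat \<Rightarrow> nat \<Rightarrow> nat \<Rightarrow> 'd::finite family \<Rightarrow> 'd::finite family \<Rightarrow> (nat \<Rightarrow> nat \<Rightarrow> real) \<Rightarrow> bool" where
  "membership_update m K n T x C u \<longleftrightarrow>
     (\<forall>i\<in>{1..n}.
        if \<exists>j\<in>{1..K}. traj_dist T (x i) (C j) = 0
        then (\<forall>k\<in>{1..K}. 0 \<le> u k i \<and> (traj_dist T (x i) (C k) \<noteq> 0 \<longrightarrow> u k i = 0)) \<and>
             (\<Sum>k=1..K. u k i) = 1
        else (\<forall>k\<in>{1..K}. u k i =
                (1 / traj_dist T (x i) (C k) powr (2 / (m - 1))) /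
                (\<Sum>j=1..K. 1 / traj_dist T (x i) (C j) powr (2 / (m - 1)))))"

definition fcm_initial ::
  "real \<Rightarrow> nat \<Rightarrow> nat \<Rightarrow> nat \<Rightarrow> 'd::finite family \<Rightarrow> (nat \<Rightarrow> nat \<Rightarrow> real) \<Rightarrow> bool" where
  "fcm_initial m K n T x u \<longleftrightarrow>
     memberships K n u \<or> (\<exists>C. membership_update m K n T x C u)"

text \<open>
  \<open>fcm_yields m \<epsilon> K n T x C u\<close>: some run of the algorithm with threshold \<open>\<epsilon>\<close> on the data \<open>x\<close>, with
  any choice of the initial memberships, stops with output \<open>C\<close>, \<open>u\<close>. Here \<open>N\<close> is the number of
  passes, and \<open>Cs s\<close>, \<open>us s\<close> are the centres and memberships after pass \<open>s\<close>. The first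
  pass has no earlier objective value to improve on, so a run has at least two passes.
\<close>

definition fcm_yields ::
  "real \<Rightarrow> real \<Rightarrow> nat \<Rightarrow> nat \<Rightarrow> nat \<Rightarrow> 'd::finite family \<Rightarrow> 'd::finite family \<Rightarrow> (nat \<Rightarrow> nat \<Rightarrow> real) \<Rightarrow> bool" where
  "fcm_yields m \<epsilon> K n T x C u \<longleftrightarrow>
     (\<exists>(N::nat) Cs us.
        let J = (\<lambda>s. fcm_objective m K n T x (Cs s) (us s)) in
        2 \<le> N \<and>
        fcm_initial m K n T x (us 0) \<and>
        (\<forall>s\<in>{1..N}. centre_update m K n T x (us (s - 1)) (Cs s) \<and>
                    membership_update m K n T x (Cs s) (us s)) \<and>
        (\<forall>s\<in>{2..<N}. \<not> J (s - 1) - J s < \<epsilon>) \<and>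
        J (N - 1) - J N < \<epsilon> \<and>
        C = Cs N \<and> u = us N)"

definition frame_change :: "(nat \<Rightarrow> real^'d^'d) \<Rightarrow> (nat \<Rightarrow> real^'d) \<Rightarrow> 'd::finite family \<Rightarrow> 'd::finite family" where
  "frame_change Q b x = (\<lambda>i t. Q t *v x i t + b t)"

text \<open>
  A clustering algorithm is given by the relation between a dataset and its possible outputs.
  The output transforms by the centres moving with the frame, with unchanged likelihoods.
\<close>

definition frame_independent ::
  "nat \<Rightarrow> ('d::finite family \<Rightarrow> 'd::finite family \<Rightarrow> (nat \<Rightarrow> nat \<Rightarrow> real) \<Rightarrow> bool) \<Rightarrow> bool" where
  "frame_independent T A \<longleftrightarrow>
     (\<forall>x Q b C u. (\<forall>t\<in>{0..T}. orthogonal_matrix (Q t)) \<longrightarrow> A x C u \<longrightarrow>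
        A (frame_change Q b x) (frame_change Q b C) u)"

end

theory Submission
  imports Defs
begin

text \<open>
  The affine part of a frame change cancels in differences, and the orthogonal part preserves norms
  (\<open>traj_dist_frame_change\<close>). The objective and the membership update see the data and the centres
  only through their mutual distances, so both are unaffected when data and centres move together.
  The centre update is a weighted mean whose normalised weights sum to 1, hence it commutes with
  every affine map (\<open>centre_update_frame_change\<close>).

  The image of a run is therefore a run, with the same memberships, the same objective values
  and hence the same stopping time. For minimisers, competitors on the transformed data must also be
  compared with competitors on the original data; this is possible because every family of centres
  is, at the relevant times, the image of another one (\<open>frame_change_surj\<close>).
\<close>

lemma norm_orthogonal_matrix_vector_mult:
  fixes A :: "real^'d^'d"
  assumes "orthogonal_matrix A"
  shows "norm (A *v v) = norm v"
  using assms orthogonal_transformation_matrix[of "(*v) A"]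
  by (simp add: orthogonal_transformation_norm)

lemma traj_dist_frame_change:
  assumes "\<forall>t\<in>{0..T}. orthogonal_matrix (Q t)"
  shows "traj_dist T (frame_change Q b x i) (frame_change Q b C k) = traj_dist T (x i) (C k)"
  unfolding traj_dist_def
proof (rule L2_set_cong[OF refl])
  fix t assume "t \<in> {0..T}"
  moreover have "frame_change Q b x i t - frame_change Q b C k t = Q t *v (x i t - C k t)"
    by (simp add: frame_change_def matrix_vector_mult_diff_distrib)
  ultimately show "norm (frame_change Q b x i t - frame_change Q b C k t) = norm (x i t - C k t)"
    using assms by (simp add: norm_orthogonal_matrix_vector_mult)
qed

lemma fcm_objective_frame_change:
  assumes "\<forall>t\<in>{0..T}. orthogonal_matrix (Q t)"
  shows "fcm_objective m K n T (frame_change Q b x) (frame_change Q b C) u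
    = fcm_objective m K n T x C u"
  by (simp only: fcm_objective_def traj_dist_frame_change[OF assms])

lemma fcm_objective_cong:
  assumes "\<And>k t. t \<in> {0..T} \<Longrightarrow> C k t = D k t"
  shows "fcm_objective m K n T x C u = fcm_objective m K n T x D u"
proof -
  have "traj_dist T (x i) (C k) = traj_dist T (x i) (D k)" for i k
    unfolding traj_dist_def using assms by (intro L2_set_cong) auto
  then show ?thesis by (simp add: fcm_objective_def)
qed

text \<open>
  Outside \<open>{0..T}\<close> the matrices may be singular, so only agreement at the relevant times can be
  asked for.
\<close>

lemma frame_change_surj:
  fixes D :: "'d::finite family"
  assumes "\<forall>t\<in>{0..T}. orthogonal_matrix (Q t)"
  obtains D' where "\<And>k t. t \<in> {0..T} \<Longrightarrow> frame_change Q b D' k t = D k t"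
proof
  fix k t assume "t \<in> {0..T}"
  then have "Q t ** transpose (Q t) = mat 1"
    using assms by (simp add: orthogonal_matrix_def)
  then show "frame_change Q b (\<lambda>k t. transpose (Q t) *v (D k t - b t)) k t = D k t"
    by (simp add: frame_change_def matrix_vector_mul_assoc del: transpose_matrix_vector)
qed

lemma affine_weighted_mean:
  fixes A :: "real^'d^'e"
  assumes "(\<Sum>i\<in>I. w i) \<noteq> 0"
  shows "A *v ((\<Sum>i\<in>I. w i *\<^sub>R f i) /\<^sub>R (\<Sum>i\<in>I. w i)) + c
    = (\<Sum>i\<in>I. w i *\<^sub>R (A *v f i + c)) /\<^sub>R (\<Sum>i\<in>I. w i)"
proof -
  have "(\<Sum>i\<in>I. w i *\<^sub>R (A *v f i + c))
      = A *v (\<Sum>i\<in>I. w i *\<^sub>R f i) + (\<Sum>i\<in>I. w i) *\<^sub>R c"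
    by (simp add: scaleR_right_distrib sum.distrib matrix_vector_mult_scaleR linear_sum
        flip: scaleR_sum_left)
  then show ?thesis
    using assms by (simp add: scaleR_right_distrib matrix_vector_mult_scaleR)
qed

lemma centre_update_frame_change:
  assumes "centre_update m K n T x u C"
  shows "centre_update m K n T (frame_change Q b x) u (frame_change Q b C)"
  using assms by (simp add: centre_update_def frame_change_def affine_weighted_mean)

lemma membership_update_frame_change:
  assumes "\<forall>t\<in>{0..T}. orthogonal_matrix (Q t)"
  shows "membership_update m K n T (frame_change Q b x) (frame_change Q b C) u
    \<longleftrightarrow> membership_update m K n T x C u"
  by (simp only: membership_update_def traj_dist_frame_change[OF assms])

lemma fcm_minimiser_frame_change:
  assumes Q: "\<forall>t\<in>{0..T}. orthogonal_matrix (Q t)"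
    and min: "fcm_minimiser m K n T x C u"
  shows "fcm_minimiser m K n T (frame_change Q b x) (frame_change Q b C) u"
  unfolding fcm_minimiser_def
proof (intro conjI allI impI)
  show "memberships K n u"
    using min by (simp add: fcm_minimiser_def)
next
  fix D :: "'a family" and v
  assume v: "memberships K n v"
  obtain D' where D': "\<And>k t. t \<in> {0..T} \<Longrightarrow> frame_change Q b D' k t = D k t"
    using frame_change_surj[of T Q b D] Q by blast
  have "fcm_objective m K n T (frame_change Q b x) (frame_change Q b C) u
      = fcm_objective m K n T x C u"
    using Q by (rule fcm_objective_frame_change)
  also have "\<dots> \<le> fcm_objective m K n T x D' v"
    using min v by (simp add: fcm_minimiser_def)
  also have "\<dots> = fcm_objective m K n T (frame_change Q b x) (frame_change Q b D') v"
    using Q by (rule fcm_objective_frame_change[symmetric])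
  also have "\<dots> = fcm_objective m K n T (frame_change Q b x) D v"
    using D' by (rule fcm_objective_cong)
  finally show "fcm_objective m K n T (frame_change Q b x) (frame_change Q b C) u
      \<le> fcm_objective m K n T (frame_change Q b x) D v" .
qed

lemma fcm_initial_frame_change:
  assumes "\<forall>t\<in>{0..T}. orthogonal_matrix (Q t)"
    and "fcm_initial m K n T x u"
  shows "fcm_initial m K n T (frame_change Q b x) u"
  using assms(2) membership_update_frame_change[OF assms(1)]
  unfolding fcm_initial_def by blast

lemma fcm_yields_frame_change:
  assumes Q: "\<forall>t\<in>{0..T}. orthogonal_matrix (Q t)"
    and "fcm_yields m \<epsilon> K n T x C u"
  shows "fcm_yields m \<epsilon> K n T (frame_change Q b x) (frame_change Q b C) u"
proof -
  obtain N :: nat and Cs us where run: "2 \<le> N" "fcm_initial m K n T x (us 0)"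
    "\<forall>s\<in>{1..N}. centre_update m K n T x (us (s - 1)) (Cs s)"
    "\<forall>s\<in>{1..N}. membership_update m K n T x (Cs s) (us s)"
    and stop: "\<forall>s\<in>{2..<N}. \<not> fcm_objective m K n T x (Cs (s - 1)) (us (s - 1))
        - fcm_objective m K n T x (Cs s) (us s) < \<epsilon>"
      "fcm_objective m K n T x (Cs (N - 1)) (us (N - 1))
        - fcm_objective m K n T x (Cs N) (us N) < \<epsilon>"
    and out: "C = Cs N" "u = us N"
    using assms(2) unfolding fcm_yields_def Let_def by blast
  show ?thesis
    unfolding fcm_yields_def Let_def
  proof (intro exI conjI ballI)
    show "2 \<le> N" by (fact run(1))
    show "fcm_initial m K n T (frame_change Q b x) (us 0)"
      using Q run(2) by (rule fcm_initial_frame_change)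
    show "frame_change Q b C = (\<lambda>s. frame_change Q b (Cs s)) N" "u = us N"
      using out by simp_all
  qed (use run stop in \<open>simp_all add: fcm_objective_frame_change[OF Q]
      membership_update_frame_change[OF Q] centre_update_frame_change\<close>)
qed

theorem mainTheorem1:
  fixes m \<epsilon> :: real and K n T :: nat
  assumes "1 < m"
  shows "frame_independent T
           (fcm_minimiser m K n T :: 'd::finite family \<Rightarrow> 'd family \<Rightarrow> (nat \<Rightarrow> nat \<Rightarrow> real) \<Rightarrow> bool) \<and>
         frame_independent T
           (fcm_yields m \<epsilon> K n T :: 'd::finite family \<Rightarrow> 'd family \<Rightarrow> (nat \<Rightarrow> nat \<Rightarrow> real) \<Rightarrow> bool)"
  unfolding frame_independent_def
  using fcm_minimiser_frame_change fcm_yields_frame_change by blast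

end
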